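(* Let $G$ be a canonical acyclic directed mixed graph with finite vertex set $V$, let $\mathsf P$ be the distribution of a non-singular Gaussian linear system with respect to $G$ with weight function $\sigma$ and positive definite noise covariance $\Lambda$, and let $\{V_j\},\{V_k\},L\subset V$ be disjoint. Suppose that (i) there is no right-directed walk in $G$ from $V_j$ or from $V_k$ to a vertex of $L$; and (ii) there is no confounding path from $V_j$ to $V_k$ in $G$ that is not ancestrally blocked by $L$. If there is a right-directed walk from $V_j$ to $V_k$ in $G$, then $$\gamma(V_k,V_j\mid L)=\sigma\big(\{\text{right-directed paths from }V_j\text{ to }V_k\text{ in }G\}\big).$$
   Context: A directed mixed graph $G=(V,\mathcal D,\mathcal B)$ consists of a finite vertex set $V=\{V_1,\dots,V_d\}$, a set $\mathcal D\subseteq V\times V$ of directed edges ($(a,b)\in\mathcal D$ is written $a\to b$) and a symmetric set $\mathcal B\subseteq V\times V$ of bidirected edges ($a\leftrightarrow b$); loops are allowed in general. $G$ is canonical if $a\leftrightarrow a$ for every $a\in V$. A walk from $a$ to $b$ is a sequence $a=v_0,e_1,v_1,\dots,e_n,v_n=b$, $n\ge 1$, where each $e_i$ is an edge $v_{i-1}\to v_i$, $v_{i-1}\leftarrow v_i$ (a directed edge $v_i\to v_{i-1}$ traversed backwards) or $v_{i-1}\leftrightarrow v_i$. Its non-endpoints are the entries at positions $v_1,\dots,v_{n-1}$. A path is a walk without repeated vertices. A right-directed (left-directed) walk has all edges of the form $\to$ ($\leftarrow$); $G$ is acyclic if there is no right-directed walk from a vertex to itself. A non-endpoint $v_i$ is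 a collider on the walk if both $e_i$ and $e_{i+1}$ have an arrowhead at $v_i$. An arc is a walk consisting of a (possibly empty) sequence of edges $\leftarrow$, then at most one bidirected edge, then a (possibly empty) sequence of edges $\to$ (with at least one edge in total). A confounding arc is an arc that is neither right-directed nor left-directed. A confounding path is a path that is the concatenation of one or several confounding arcs. A walk in $G$ is ancestrally blocked by $L\subseteq V$ if it contains a collider $v$ such that $v\notin L$ and there is no right-directed walk in $G$ from $v$ to a vertex of $L$, or it contains a non-endpoint in $L$ that is not a collider. Gaussian linear systems: vertices are identified with the components of a random vector $V=(V_1,\dots,V_d)$. A weight function $\sigma$ assigns a real number to each edge of $G$ (the same for $a\leftrightarrow b$ and $b\leftrightarrow a$; zero weights are permitted) and determines matrices by $\beta_{ab}=\sigma(a\to b)$ if $a\to b$ in $G$ and $0$ otherwise, $\Lambda_{ab}=\sigma(a\leftrightarrow b)$ if $a\leftrightarrow b$ in $G$ and $0$ otherwise. The Gaussian linear system is $V=\beta^TV+E$ with $E\sim\mathrm N(0,\Lambda)$; it is non-singular if $\mathrm{Id}-\beta$ is invertible, and then $V\sim\mathrm N(0,(\mathrm{Id}-\beta)^{-T}\Lambda(\mathrm{Id}-\beta)^{-1})$. The weight of a walk is the product of its edge weights and the weight of a set of walks is the sum of the weights of its elements ($0$ for the empty set). Regression coefficient: $\gamma(V_k,V_j\mid L)=\mathrm{Cov}(V_k,V_j\mid L)/\mathrm{Var}(V_j\mid L)$ under $\mathsf P$, i.e. the coefficient of $V_j$ in the linear regression of $V_k$ on $V_j$ and $L$; equivalently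 $-(\tilde\Sigma^{-1})_{jk}/(\tilde\Sigma^{-1})_{kk}$, where $\tilde\Sigma$ is the covariance matrix of $(V_j,V_k,L)$. *)

theory Defs
  imports "HOL-Probability.Probability"
begin

section \<open>Directed mixed graphs\<close>

text \<open>The vertex set is the finite type \<open>'v\<close>.\<close>

record 'v mixed_graph =
  directed :: "('v \<times> 'v) set"
  bidirected :: "('v \<times> 'v) set"

definition directed_mixed_graph :: "'v::finite mixed_graph \<Rightarrow> bool" where
  "directed_mixed_graph G \<longleftrightarrow> sym (bidirected G)"

definition canonical :: "'v::finite mixed_graph \<Rightarrow> bool" where
  "canonical G \<longleftrightarrow> (\<forall>a. (a, a) \<in> bidirected G)"

text \<open>\<open>Dir a b\<close> is \<open>a \<rightarrow> b\<close>. The terms \<open>Bid a b\<close> and \<open>Bid b a\<close> denote the same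
  bidirected edge; this is reflected in the symmetry required of weight functions.\<close>

datatype 'v edge = Dir 'v 'v | Bid 'v 'v

definition edges :: "'v mixed_graph \<Rightarrow> 'v edge set" where
  "edges G = {Dir a b | a b. (a, b) \<in> directed G} \<union> {Bid a b | a b. (a, b) \<in> bidirected G}"

section \<open>Walks\<close>

text \<open>The walk \<open>v\<^sub>0, e\<^sub>1, v\<^sub>1, \<dots>, e\<^sub>n, v\<^sub>n\<close> is encoded by the list of its vertices and the list of
  the ways in which its edges are traversed: \<open>Fwd\<close> for \<open>\<rightarrow>\<close>, \<open>Bwd\<close> for \<open>\<leftarrow>\<close>, \<open>Bi\<close> for \<open>\<leftrightarrow>\<close>.
  The list entry with index \<open>i\<close> is the edge \<open>e\<close> with index \<open>i + 1\<close>.\<close>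

datatype kind = Fwd | Bwd | Bi

type_synonym 'v walk = "'v list \<times> kind list"

definition vertices :: "'v walk \<Rightarrow> 'v list" where
  "vertices w = fst w"

definition kinds :: "'v walk \<Rightarrow> kind list" where
  "kinds w = snd w"

fun traversed_edge :: "'v \<Rightarrow> kind \<Rightarrow> 'v \<Rightarrow> 'v edge" where
  "traversed_edge a Fwd b = Dir a b"
| "traversed_edge a Bwd b = Dir b a"
| "traversed_edge a Bi b = Bid a b"

definition walk_edge :: "'v walk \<Rightarrow> nat \<Rightarrow> 'v edge" where
  "walk_edge w i = traversed_edge (vertices w ! i) (kinds w ! i) (vertices w ! Suc i)"

definition is_walk :: "'v mixed_graph \<Rightarrow> 'v walk \<Rightarrow> bool" where
  "is_walk G w \<longleftrightarrow> kinds w \<noteq> [] \<and> length (vertices w) = Suc (length (kinds w)) \<and>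
     (\<forall>i < length (kinds w). walk_edge w i \<in> edges G)"

definition walk_between :: "'v mixed_graph \<Rightarrow> 'v \<Rightarrow> 'v \<Rightarrow> 'v walk \<Rightarrow> bool" where
  "walk_between G a b w \<longleftrightarrow> is_walk G w \<and> hd (vertices w) = a \<and> last (vertices w) = b"

definition is_path :: "'v mixed_graph \<Rightarrow> 'v walk \<Rightarrow> bool" where
  "is_path G w \<longleftrightarrow> is_walk G w \<and> distinct (vertices w)"

definition right_directed :: "'v walk \<Rightarrow> bool" where
  "right_directed w \<longleftrightarrow> set (kinds w) \<subseteq> {Fwd}"

definition left_directed :: "'v walk \<Rightarrow> bool" where
  "left_directed w \<longleftrightarrow> set (kinds w) \<subseteq> {Bwd}"

definition right_directed_walk_exists :: "'v mixed_graph \<Rightarrow> 'v \<Rightarrow> 'v \<Rightarrow> bool" where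
  "right_directed_walk_exists G a b \<longleftrightarrow> (\<exists>w. walk_between G a b w \<and> right_directed w)"

definition acyclic_graph :: "'v mixed_graph \<Rightarrow> bool" where
  "acyclic_graph G \<longleftrightarrow> (\<forall>a. \<not> right_directed_walk_exists G a a)"

section \<open>Colliders and blocking\<close>

definition nonendpoint :: "'v walk \<Rightarrow> nat \<Rightarrow> bool" where
  "nonendpoint w i \<longleftrightarrow> 0 < i \<and> i < length (kinds w)"

definition collider :: "'v walk \<Rightarrow> nat \<Rightarrow> bool" where
  "collider w i \<longleftrightarrow> nonendpoint w i \<and>
     kinds w ! (i - 1) \<in> {Fwd, Bi} \<and> kinds w ! i \<in> {Bwd, Bi}"

definition ancestrally_blocked :: "'v mixed_graph \<Rightarrow> 'v set \<Rightarrow> 'v walk \<Rightarrow> bool" where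
  "ancestrally_blocked G L w \<longleftrightarrow>
     (\<exists>i. collider w i \<and> vertices w ! i \<notin> L \<and>
          \<not> (\<exists>l \<in> L. right_directed_walk_exists G (vertices w ! i) l)) \<or>
     (\<exists>i. nonendpoint w i \<and> \<not> collider w i \<and> vertices w ! i \<in> L)"

section \<open>Confounding arcs and paths\<close>

definition is_arc :: "'v mixed_graph \<Rightarrow> 'v walk \<Rightarrow> bool" where
  "is_arc G w \<longleftrightarrow> is_walk G w \<and>
     (\<exists>m n mid. (mid = [] \<or> mid = [Bi]) \<and> kinds w = replicate m Bwd @ mid @ replicate n Fwd)"

definition confounding_arc :: "'v mixed_graph \<Rightarrow> 'v walk \<Rightarrow> bool" where
  "confounding_arc G w \<longleftrightarrow> is_arc G w \<and> \<not> right_directed w \<and> \<not> left_directed w"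

text \<open>Only meaningful if the first walk ends where the second one starts.\<close>

definition concat_walk :: "'v walk \<Rightarrow> 'v walk \<Rightarrow> 'v walk" where
  "concat_walk u w = (vertices u @ tl (vertices w), kinds u @ kinds w)"

inductive confounding_arcs :: "'v mixed_graph \<Rightarrow> 'v walk \<Rightarrow> bool" for G where
  single: "confounding_arc G w \<Longrightarrow> confounding_arcs G w"
| append: "confounding_arc G u \<Longrightarrow> confounding_arcs G w \<Longrightarrow> last (vertices u) = hd (vertices w)
     \<Longrightarrow> confounding_arcs G (concat_walk u w)"

definition confounding_path :: "'v mixed_graph \<Rightarrow> 'v walk \<Rightarrow> bool" where
  "confounding_path G w \<longleftrightarrow> is_path G w \<and> confounding_arcs G w"

section \<open>Weights\<close>

definition weight_function :: "'v::finite mixed_graph \<Rightarrow> ('v edge \<Rightarrow> real) \<Rightarrow> bool" where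
  "weight_function G \<sigma> \<longleftrightarrow> (\<forall>(a, b) \<in> bidirected G. \<sigma> (Bid a b) = \<sigma> (Bid b a))"

definition walk_weight :: "('v edge \<Rightarrow> real) \<Rightarrow> 'v walk \<Rightarrow> real" where
  "walk_weight \<sigma> w = (\<Prod>i < length (kinds w). \<sigma> (walk_edge w i))"

text \<open>To be used for finite sets of walks only.\<close>

definition weight :: "('v edge \<Rightarrow> real) \<Rightarrow> 'v walk set \<Rightarrow> real" where
  "weight \<sigma> W = (\<Sum>w \<in> W. walk_weight \<sigma> w)"

definition right_directed_paths :: "'v mixed_graph \<Rightarrow> 'v \<Rightarrow> 'v \<Rightarrow> 'v walk set" where
  "right_directed_paths G a b = {w. is_path G w \<and> walk_between G a b w \<and> right_directed w}"

definition coeff_matrix :: "'v::finite mixed_graph \<Rightarrow> ('v edge \<Rightarrow> real) \<Rightarrow> real^'v^'v" where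
  "coeff_matrix G \<sigma> = (\<chi> a b. if (a, b) \<in> directed G then \<sigma> (Dir a b) else 0)"

definition noise_covariance :: "'v::finite mixed_graph \<Rightarrow> ('v edge \<Rightarrow> real) \<Rightarrow> real^'v^'v" where
  "noise_covariance G \<sigma> = (\<chi> a b. if (a, b) \<in> bidirected G then \<sigma> (Bid a b) else 0)"

section \<open>Gaussian linear systems\<close>

definition positive_definite :: "real^'v^'v::finite \<Rightarrow> bool" where
  "positive_definite A \<longleftrightarrow> transpose A = A \<and> (\<forall>x. x \<noteq> 0 \<longrightarrow> x \<bullet> (A *v x) > 0)"

text \<open>\<open>Z \<sim> N(0, C)\<close>: every linear combination \<open>a \<bullet> Z\<close> is normally distributed with mean \<open>0\<close> and
  variance \<open>a\<^sup>T C a\<close>, where \<open>N(0, 0)\<close> is the point mass at \<open>0\<close>. Note that the second argument of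
  \<open>normal_density\<close> is the standard deviation.\<close>

definition centered_gaussian :: "'w measure \<Rightarrow> ('w \<Rightarrow> real^'v::finite) \<Rightarrow> real^'v^'v \<Rightarrow> bool" where
  "centered_gaussian M Z C \<longleftrightarrow> Z \<in> borel_measurable M \<and>
     (\<forall>a. let s = a \<bullet> (C *v a) in
        s \<ge> 0 \<and>
        (s = 0 \<longrightarrow> (AE \<omega> in M. a \<bullet> Z \<omega> = 0)) \<and>
        (s > 0 \<longrightarrow> distributed M lborel (\<lambda>\<omega>. a \<bullet> Z \<omega>) (\<lambda>x. ennreal (normal_density 0 (sqrt s) x))))"

definition gaussian_linear_system ::
  "'v::finite mixed_graph \<Rightarrow> ('v edge \<Rightarrow> real) \<Rightarrow> 'w measure
     \<Rightarrow> ('w \<Rightarrow> real^'v) \<Rightarrow> ('w \<Rightarrow> real^'v) \<Rightarrow> bool" where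
  "gaussian_linear_system G \<sigma> M X E \<longleftrightarrow>
     weight_function G \<sigma> \<and> prob_space M \<and> X \<in> borel_measurable M \<and>
     centered_gaussian M E (noise_covariance G \<sigma>) \<and>
     (AE \<omega> in M. X \<omega> = transpose (coeff_matrix G \<sigma>) *v X \<omega> + E \<omega>)"

definition nonsingular_system :: "'v::finite mixed_graph \<Rightarrow> ('v edge \<Rightarrow> real) \<Rightarrow> bool" where
  "nonsingular_system G \<sigma> \<longleftrightarrow> invertible (mat 1 - coeff_matrix G \<sigma>)"

section \<open>Regression coefficients\<close>

text \<open>Population linear regression (least squares, with intercept \<open>c\<close>) of the component \<open>k\<close> on the
  components in \<open>S\<close>, under a probability measure \<open>P\<close> on the Euclidean space with finite second
  moments. Only the values of the coefficient function on \<open>S\<close> matter.\<close>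

definition mean_squared_error ::
  "(real^'v::finite) measure \<Rightarrow> 'v \<Rightarrow> 'v set \<Rightarrow> real \<Rightarrow> ('v \<Rightarrow> real) \<Rightarrow> real" where
  "mean_squared_error P k S c b = (\<integral>x. (x $ k - (c + (\<Sum>i\<in>S. b i * x $ i)))\<^sup>2 \<partial>P)"

definition linear_regression ::
  "(real^'v::finite) measure \<Rightarrow> 'v \<Rightarrow> 'v set \<Rightarrow> real \<Rightarrow> ('v \<Rightarrow> real) \<Rightarrow> bool" where
  "linear_regression P k S c b \<longleftrightarrow>
     (\<forall>c' b'. mean_squared_error P k S c b \<le> mean_squared_error P k S c' b')"

text \<open>\<open>regression_coefficient P k j L\<close> is \<open>\<gamma>(V\<^sub>k, V\<^sub>j | L)\<close>, the coefficient of \<open>V\<^sub>j\<close> in the linear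
  regression of \<open>V\<^sub>k\<close> on \<open>V\<^sub>j\<close> and \<open>L\<close>. It is uniquely determined if the covariance matrix of
  \<open>P\<close> is positive definite.\<close>

definition regression_coefficient ::
  "(real^'v::finite) measure \<Rightarrow> 'v \<Rightarrow> 'v \<Rightarrow> 'v set \<Rightarrow> real" where
  "regression_coefficient P k j L =
     (THE g. \<exists>c b. linear_regression P k (insert j L) c b \<and> g = b j)"

end

theory Submission
  imports Defs
begin

text \<open>Let \<open>S = {j, k} \<union> L\<close>. Removing all edges that leave \<open>S\<close> gives a system with solution \<open>f\<close>, driven
  by the same noise, in which the vertices of \<open>S\<close> are sinks; the original solution satisfies
  \<open>x\<^sub>v = f\<^sub>v + \<Sum>\<^sub>s C\<^sub>s\<^sub>v x\<^sub>s\<close> over \<open>s \<in> S\<close>, where \<open>C\<^sub>s\<^sub>v\<close> is the weight of the right-directed paths from \<open>s\<close> to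
  \<open>v\<close> without interior vertices in \<open>S\<close>. As \<open>j\<close> has no descendants in \<open>L\<close>, \<open>C\<^sub>j\<^sub>k\<close> is the weight of all
  right-directed paths from \<open>j\<close> to \<open>k\<close>.
  If \<open>f\<^sub>s\<close> and \<open>f\<^sub>t\<close> are correlated for distinct \<open>s, t \<in> S\<close>, there is a confounding arc from \<open>s\<close> to \<open>t\<close> with
  interior outside \<open>S\<close>. A chain of such arcs from \<open>j\<close> to \<open>k\<close> through \<open>L\<close> is a walk that is not blocked,
  and cutting out its loops leaves a confounding path that is not blocked. So no such chain exists, the
  Gram matrix of \<open>f\<close> on \<open>S\<close> is block diagonal, and the residual of the projection of \<open>f\<^sub>k\<close> onto the \<open>f\<^sub>l\<close> in the block
  of \<open>k\<close> is orthogonal to all regressors. This residual has the form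
  \<open>x\<^sub>k - C\<^sub>j\<^sub>k x\<^sub>j - \<Sum>\<^sub>l b\<^sub>l x\<^sub>l\<close> with \<open>l \<in> L\<close>.\<close>

section \<open>Directed walks\<close>

lemma in_edges_iff [simp]:
  "Dir a b \<in> edges G \<longleftrightarrow> (a, b) \<in> directed G"
  "Bid a b \<in> edges G \<longleftrightarrow> (a, b) \<in> bidirected G"
  by (auto simp: edges_def)

lemma is_walk_Pair:
  "is_walk G (vs, ks) \<longleftrightarrow> ks \<noteq> [] \<and> length vs = Suc (length ks) \<and>
     (\<forall>i < length ks. traversed_edge (vs ! i) (ks ! i) (vs ! Suc i) \<in> edges G)"
  by (simp add: is_walk_def walk_edge_def vertices_def kinds_def)

text \<open>Stated for segments so that it applies between two visits to the same vertex, where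
  acyclicity yields a contradiction.\<close>

lemma forward_segment_trancl:
  assumes walk: "is_walk G w" and "p < q" "q \<le> length (kinds w)"
    and fwd: "\<And>i. p \<le> i \<Longrightarrow> i < q \<Longrightarrow> kinds w ! i = Fwd"
  shows "(vertices w ! p, vertices w ! q) \<in> (directed G)\<^sup>+"
  using assms(2-)
proof (induction q)
  case (Suc q)
  have "kinds w ! q = Fwd" "walk_edge w q \<in> edges G"
    using walk Suc.prems by (auto simp: is_walk_def)
  then have "(vertices w ! q, vertices w ! Suc q) \<in> directed G"
    by (simp add: walk_edge_def)
  then show ?case
    using Suc by (cases "p = q") (auto intro: trancl_into_trancl)
qed simp

lemma right_directed_nth: "right_directed w \<Longrightarrow> i < length (kinds w) \<Longrightarrow> kinds w ! i = Fwd"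
  unfolding right_directed_def using nth_mem by blast

lemma right_directed_walk_exists_iff:
  "right_directed_walk_exists G a b \<longleftrightarrow> (a, b) \<in> (directed G)\<^sup>+"
proof
  assume "right_directed_walk_exists G a b"
  then obtain w where w: "is_walk G w" "hd (vertices w) = a" "last (vertices w) = b" "right_directed w"
    by (auto simp: right_directed_walk_exists_def walk_between_def)
  have "(vertices w ! 0, vertices w ! length (kinds w)) \<in> (directed G)\<^sup>+"
    by (rule forward_segment_trancl[OF w(1)]) (use w in \<open>auto simp: is_walk_def right_directed_nth\<close>)
  moreover have "vertices w \<noteq> []" "length (vertices w) = Suc (length (kinds w))"
    using w(1) by (auto simp: is_walk_def)
  ultimately show "(a, b) \<in> (directed G)\<^sup>+"
    using w by (simp add: hd_conv_nth last_conv_nth)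
next
  assume "(a, b) \<in> (directed G)\<^sup>+"
  then show "right_directed_walk_exists G a b"
  proof (induction rule: converse_trancl_induct)
    case (base a)
    then have "walk_between G a b ([a, b], [Fwd])" "right_directed ([a, b], [Fwd])"
      by (simp_all add: walk_between_def is_walk_Pair vertices_def kinds_def right_directed_def)
    then show ?case unfolding right_directed_walk_exists_def by blast
  next
    case (step a m)
    then obtain vs ks where w: "walk_between G m b (vs, ks)" "right_directed (vs, ks)"
      by (auto simp: right_directed_walk_exists_def)
    then have "vs \<noteq> []" "hd vs = m" by (auto simp: walk_between_def is_walk_Pair vertices_def)
    then have "walk_between G a b (a # vs, Fwd # ks)" "right_directed (a # vs, Fwd # ks)"
      using w step(1) by (auto simp: walk_between_def is_walk_Pair vertices_def kinds_def
          right_directed_def less_Suc_eq_0_disj hd_conv_nth)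
    then show ?case unfolding right_directed_walk_exists_def by blast
  qed
qed

lemma acyclic_graph_iff: "acyclic_graph G \<longleftrightarrow> acyclic (directed G)"
  by (simp add: acyclic_graph_def acyclic_def right_directed_walk_exists_iff)

section \<open>Path weights\<close>

text \<open>Unlike \<open>walk_between\<close>, this includes the walk without edges.\<close>

definition forward_walks :: "'v mixed_graph \<Rightarrow> 'v \<Rightarrow> 'v \<Rightarrow> 'v walk set" where
  "forward_walks G a b = {(vs, ks). length vs = Suc (length ks) \<and> set ks \<subseteq> {Fwd} \<and>
     (\<forall>i < length ks. (vs ! i, vs ! Suc i) \<in> directed G) \<and> hd vs = a \<and> last vs = b}"

definition cons_walk :: "'v \<Rightarrow> 'v walk \<Rightarrow> 'v walk" where
  "cons_walk a w = (a # vertices w, Fwd # kinds w)"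

text \<open>Split off the first edge; the remainder may be empty. Acyclicity ensures that prepending
  a vertex cannot create a repetition.\<close>

lemma right_directed_paths_eq_UN:
  assumes "acyclic_graph G"
  shows "right_directed_paths G a b = (\<Union>m \<in> {m. (a, m) \<in> directed G}. cons_walk a ` forward_walks G m b)"
    (is "?L = ?R")
proof (intro set_eqI iffI)
  fix w assume w: "w \<in> ?L"
  obtain vs ks where [simp]: "w = (vs, ks)" by fastforce
  have wk: "is_walk G w" "right_directed w" "hd vs = a" "last vs = b"
    using w by (auto simp: right_directed_paths_def walk_between_def vertices_def)
  from wk(1) obtain ks' k where ks: "ks = k # ks'" by (auto simp: is_walk_Pair neq_Nil_conv)
  from wk(1) ks obtain m vs' where vs: "vs = a # m # vs'"
    using wk(3) by (auto simp: is_walk_Pair length_Suc_conv)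
  have k: "k = Fwd" "set ks' \<subseteq> {Fwd}" using wk(2) ks by (auto simp: right_directed_def kinds_def)
  have e: "(vs ! i, vs ! Suc i) \<in> directed G" if "i < length ks" for i
  proof -
    have "ks ! i = Fwd" "traversed_edge (vs ! i) (ks ! i) (vs ! Suc i) \<in> edges G"
      using wk(1) right_directed_nth[OF wk(2), of i] that by (auto simp: is_walk_Pair kinds_def)
    then show ?thesis by simp
  qed
  have "(a, m) \<in> directed G" using e[of 0] ks vs by simp
  moreover have "(m # vs', ks') \<in> forward_walks G m b"
    using wk k ks vs e[of "Suc i" for i] by (auto simp: forward_walks_def is_walk_Pair)
  moreover have "w = cons_walk a (m # vs', ks')"
    using ks vs k by (simp add: cons_walk_def vertices_def kinds_def)
  ultimately show "w \<in> ?R" by blast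
next
  fix w assume "w \<in> ?R"
  then obtain m vs ks where m: "(a, m) \<in> directed G" "(vs, ks) \<in> forward_walks G m b"
    and w: "w = (a # vs, Fwd # ks)"
    by (auto simp: cons_walk_def vertices_def kinds_def)
  have fw: "length vs = Suc (length ks)" "set ks \<subseteq> {Fwd}" "hd vs = m" "last vs = b"
      "\<And>i. i < length ks \<Longrightarrow> (vs ! i, vs ! Suc i) \<in> directed G"
    using m(2) by (auto simp: forward_walks_def)
  have kf: "ks ! i = Fwd" if "i < length ks" for i using fw(2) that nth_mem by blast
  have vs: "vs \<noteq> []" using fw by auto
  have walk: "is_walk G w"
    using m(1) fw vs kf by (auto simp: w is_walk_Pair less_Suc_eq_0_disj hd_conv_nth)
  have rd: "right_directed w" using fw by (auto simp: w right_directed_def kinds_def)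
  have "distinct (vertices w)"
  proof (rule ccontr)
    assume "\<not> distinct (vertices w)"
    then obtain p q where pq: "p < q" "q < length (vertices w)" "vertices w ! p = vertices w ! q"
      by (metis distinct_conv_nth linorder_neqE_nat)
    have "(vertices w ! p, vertices w ! q) \<in> (directed G)\<^sup>+"
      by (rule forward_segment_trancl[OF walk pq(1)])
        (use walk pq in \<open>auto simp: is_walk_def right_directed_nth[OF rd]\<close>)
    with pq assms show False by (auto simp: acyclic_graph_iff acyclic_def)
  qed
  with walk rd fw vs show "w \<in> ?L"
    by (auto simp: right_directed_paths_def is_path_def walk_between_def w vertices_def)
qed

lemma forward_walks_eq:
  assumes "acyclic_graph G"
  shows "forward_walks G a b = right_directed_paths G a b \<union> (if a = b then {([b], [])} else {})"
    (is "?L = ?R")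
proof (intro set_eqI iffI)
  fix w assume w: "w \<in> ?L"
  obtain vs ks where [simp]: "w = (vs, ks)" by fastforce
  show "w \<in> ?R"
  proof (cases ks)
    case Nil
    then show ?thesis using w by (auto simp: forward_walks_def length_Suc_conv)
  next
    case (Cons k ks')
    then obtain m vs' where vs: "vs = a # m # vs'"
      using w by (auto simp: forward_walks_def length_Suc_conv)
    have "(m # vs', ks') \<in> forward_walks G m b" "(a, m) \<in> directed G" "k = Fwd"
      using w Cons vs by (auto simp: forward_walks_def)
    then show ?thesis
      unfolding right_directed_paths_eq_UN[OF assms] using Cons vs
      by (force simp: cons_walk_def vertices_def kinds_def)
  qed
next
  have "cons_walk a u \<in> ?L" if u: "u \<in> forward_walks G m b" "(a, m) \<in> directed G" for u m
  proof -
    obtain vs ks where "u = (vs, ks)" by fastforce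
    moreover from this have "vs \<noteq> []" using u by (auto simp: forward_walks_def)
    ultimately show ?thesis using u
      by (auto simp: forward_walks_def cons_walk_def vertices_def kinds_def less_Suc_eq_0_disj hd_conv_nth)
  qed
  moreover have "([b], []) \<in> forward_walks G b b" by (simp add: forward_walks_def)
  moreover fix w assume "w \<in> ?R"
  ultimately show "w \<in> ?L"
    unfolding right_directed_paths_eq_UN[OF assms] by (auto split: if_splits)
qed

lemma finite_right_directed_paths:
  fixes G :: "'v::finite mixed_graph"
  shows "finite (right_directed_paths G a b)"
proof -
  have "right_directed_paths G a b \<subseteq>
      {vs. set vs \<subseteq> UNIV \<and> length vs \<le> CARD('v)} \<times> {ks. set ks \<subseteq> {Fwd} \<and> length ks \<le> CARD('v)}"
    (is "_ \<subseteq> ?X")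
  proof
    fix w assume w: "w \<in> right_directed_paths G a b"
    then have "length (fst w) \<le> CARD('v)"
      by (metis (mono_tags) right_directed_paths_def is_path_def vertices_def mem_Collect_eq
          card_mono distinct_card finite subset_UNIV)
    then show "w \<in> ?X" using w
      by (cases w) (auto simp: right_directed_paths_def walk_between_def is_walk_Pair right_directed_def kinds_def)
  qed
  moreover have "finite ?X" by (intro finite_cartesian_product finite_lists_length_le) auto
  ultimately show ?thesis by (rule finite_subset)
qed

lemma walk_weight_cons_walk:
  assumes "w \<in> forward_walks G m b"
  shows "walk_weight \<sigma> (cons_walk a w) = \<sigma> (Dir a m) * walk_weight \<sigma> w"
proof -
  obtain vs ks where w: "w = (vs, ks)" by fastforce
  have "vs \<noteq> []" "hd vs = m" using assms w by (auto simp: forward_walks_def)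
  then show ?thesis
    by (simp add: w walk_weight_def cons_walk_def walk_edge_def vertices_def kinds_def
        prod.lessThan_Suc_shift hd_conv_nth del: prod.lessThan_Suc)
qed

text \<open>First-edge decomposition, the indicator being the weight of the empty walk. The entries
  of the inverse of a matrix \<open>mat 1 - N\<close> obey the same kind of recursion, which is how
  path weights are later identified with matrix entries.\<close>

lemma weight_right_directed_paths:
  fixes G :: "'v::finite mixed_graph"
  assumes "acyclic_graph G"
  shows "weight \<sigma> (right_directed_paths G a b)
    = (\<Sum>m\<in>UNIV. coeff_matrix G \<sigma> $ a $ m *
        ((if m = b then 1 else 0) + weight \<sigma> (right_directed_paths G m b)))"
proof -
  let ?F = "\<lambda>m. forward_walks G m b"
  have fin: "finite (?F m)" for m
    unfolding forward_walks_eq[OF assms] using finite_right_directed_paths by auto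
  have F: "weight \<sigma> (?F m) = (if m = b then 1 else 0) + weight \<sigma> (right_directed_paths G m b)" for m
  proof -
    have "([b], []) \<notin> right_directed_paths G m b"
      by (auto simp: right_directed_paths_def is_path_def is_walk_Pair)
    then show ?thesis
      by (auto simp: forward_walks_eq[OF assms] weight_def finite_right_directed_paths
          walk_weight_def kinds_def)
  qed
  \<comment> \<open>The second vertex determines the first edge, so the union over \<open>m\<close>
    is disjoint.\<close>
  have "hd (tl (vertices w)) = m" if "w \<in> cons_walk a ` ?F m" for w m
    using that by (auto simp: cons_walk_def forward_walks_def vertices_def)
  then have disj: "cons_walk a ` ?F m \<inter> cons_walk a ` ?F m' = {}" if "m \<noteq> m'" for m m'
    using that by blast
  have inj: "inj_on (cons_walk a) A" for A
    by (rule inj_onI) (simp add: cons_walk_def vertices_def kinds_def prod_eq_iff)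
  have "weight \<sigma> (right_directed_paths G a b)
      = (\<Sum>m\<in>{m. (a, m) \<in> directed G}. \<Sum>w\<in>cons_walk a ` ?F m. walk_weight \<sigma> w)"
    unfolding weight_def right_directed_paths_eq_UN[OF assms]
    using disj fin by (subst sum.UNION_disjoint) auto
  also have "\<dots> = (\<Sum>m\<in>{m. (a, m) \<in> directed G}. \<sigma> (Dir a m) * weight \<sigma> (?F m))"
    by (intro sum.cong refl)
      (simp add: sum.reindex[OF inj] weight_def sum_distrib_left walk_weight_cons_walk)
  also have "\<dots> = (\<Sum>m\<in>UNIV. coeff_matrix G \<sigma> $ a $ m * weight \<sigma> (?F m))"
    by (rule sum.mono_neutral_cong_left) (auto simp: coeff_matrix_def)
  finally show ?thesis by (simp add: F)
qed

section \<open>Walks with an arrowhead at both ends\<close>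

lemma replicate_prefix:
  "\<exists>n ys. xs = replicate n a @ ys \<and> (ys \<noteq> [] \<longrightarrow> hd ys \<noteq> a)"
proof (induction xs)
  case (Cons x xs)
  then obtain n ys where ys: "xs = replicate n a @ ys" "ys \<noteq> [] \<longrightarrow> hd ys \<noteq> a" by blast
  show ?case
  proof (cases "x = a")
    case True
    then have "x # xs = replicate (Suc n) a @ ys" using ys by simp
    then show ?thesis using ys(2) by blast
  next
    case False
    then have "x # xs = replicate 0 a @ x # xs \<and> (x # xs \<noteq> [] \<longrightarrow> hd (x # xs) \<noteq> a)" by simp
    then show ?thesis by blast
  qed
qed simp

text \<open>Greedy choice: a maximal run of \<open>Bwd\<close>, a \<open>Bi\<close> if one follows,
  then a maximal run of \<open>Fwd\<close>. Maximality of the last run forces the rest to start with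
  an arrowhead at its first vertex again, so the splitting can be repeated.\<close>

lemma arc_prefix:
  assumes "ks \<noteq> []" "hd ks \<in> {Bwd, Bi}" "last ks \<in> {Fwd, Bi}"
  obtains m n mid rest where
    "ks = (replicate m Bwd @ mid @ replicate n Fwd) @ rest" "mid = [] \<or> mid = [Bi]"
    "m > 0 \<or> mid = [Bi]" "mid = [Bi] \<or> n > 0" "rest \<noteq> [] \<longrightarrow> hd rest \<in> {Bwd, Bi}"
proof -
  obtain m ys where m: "ks = replicate m Bwd @ ys" "ys \<noteq> [] \<longrightarrow> hd ys \<noteq> Bwd"
    using replicate_prefix[of ks Bwd] by blast
  have ys: "ys \<noteq> []"
  proof
    assume "ys = []"
    then have "set ks \<subseteq> {Bwd}" using m by auto
    then show False using assms(3) last_in_set[OF assms(1)] by auto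
  qed
  define mid where "mid = (if hd ys = Bi then [Bi] else [])"
  define zs where "zs = (if hd ys = Bi then tl ys else ys)"
  have yz: "ys = mid @ zs" using ys by (cases ys) (auto simp: mid_def zs_def)
  obtain n rest where n: "zs = replicate n Fwd @ rest" "rest \<noteq> [] \<longrightarrow> hd rest \<noteq> Fwd"
    using replicate_prefix[of zs Fwd] by blast
  show thesis
  proof (rule that[of m mid n rest])
    show "ks = (replicate m Bwd @ mid @ replicate n Fwd) @ rest" using m yz n by simp
    show "mid = [] \<or> mid = [Bi]" by (simp add: mid_def)
    show "m > 0 \<or> mid = [Bi]"
    proof (cases "m = 0")
      case True
      then have "hd ys \<in> {Bwd, Bi}" using assms(2) m by simp
      then show ?thesis using m(2) ys by (auto simp: mid_def)
    qed simp
    show "mid = [Bi] \<or> n > 0"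
    proof (cases "hd ys")
      case Fwd
      then have "zs = ys" by (simp add: zs_def)
      then show ?thesis using n Fwd ys by (cases "n = 0") simp_all
    qed (use m(2) ys in \<open>simp_all add: mid_def\<close>)
    show "rest \<noteq> [] \<longrightarrow> hd rest \<in> {Bwd, Bi}"
      using n(2) by (cases "hd rest") auto
  qed
qed

text \<open>Arrowheads at the two ends suffice: splitting off one arc leaves a shorter walk of the
  same type. A condition on the first and last edge thus replaces the decomposition into
  arcs.\<close>

lemma confounding_arcsI:
  assumes "is_walk G (vs, ks)" "hd ks \<in> {Bwd, Bi}" "last ks \<in> {Fwd, Bi}"
  shows "confounding_arcs G (vs, ks)"
  using assms
proof (induction ks arbitrary: vs rule: length_induct)
  case (1 ks)
  have len: "ks \<noteq> []" "length vs = Suc (length ks)"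
    and e: "\<And>i. i < length ks \<Longrightarrow> traversed_edge (vs ! i) (ks ! i) (vs ! Suc i) \<in> edges G"
    using "1.prems"(1) by (auto simp: is_walk_Pair)
  obtain m n mid rest where d: "ks = (replicate m Bwd @ mid @ replicate n Fwd) @ rest"
    "mid = [] \<or> mid = [Bi]" "m > 0 \<or> mid = [Bi]" "mid = [Bi] \<or> n > 0"
    "rest \<noteq> [] \<longrightarrow> hd rest \<in> {Bwd, Bi}"
    using arc_prefix[OF len(1) "1.prems"(2,3)] .
  define ks\<^sub>1 where "ks\<^sub>1 = replicate m Bwd @ mid @ replicate n Fwd"
  define p where "p = length ks\<^sub>1"
  have ks: "ks = ks\<^sub>1 @ rest" and ks1: "ks\<^sub>1 \<noteq> []" using d by (auto simp: ks\<^sub>1_def)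
  have nr: "ks\<^sub>1 ! i = ks ! i" if "i < p" for i using that by (simp add: ks nth_append p_def)
  have nr2: "rest ! i = ks ! (p + i)" for i by (simp add: ks nth_append p_def)
  have "is_walk G (take (Suc p) vs, ks\<^sub>1)"
    using ks1 len e nr by (auto simp: is_walk_Pair ks p_def)
  moreover have "Bwd \<in> set ks\<^sub>1 \<or> Bi \<in> set ks\<^sub>1" "Fwd \<in> set ks\<^sub>1 \<or> Bi \<in> set ks\<^sub>1"
    using d(3,4) by (auto simp: ks\<^sub>1_def)
  ultimately have arc: "confounding_arc G (take (Suc p) vs, ks\<^sub>1)"
    using d(2) by (auto simp: confounding_arc_def is_arc_def right_directed_def left_directed_def
        kinds_def ks\<^sub>1_def)
  show ?case
  proof (cases "rest = []")
    case True
    then show ?thesis using arc len by (auto simp: p_def ks intro: confounding_arcs.single)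
  next
    case False
    have lens: "length ks = p + length rest" by (simp add: ks p_def)
    then have "is_walk G (drop p vs, rest)"
      using False len(2) e[of "p + i" for i] by (simp add: is_walk_Pair nr2)
    moreover have "hd rest \<in> {Bwd, Bi}" "last rest \<in> {Fwd, Bi}"
      using False d(5) "1.prems"(3) by (auto simp: ks)
    moreover have "length rest < length ks" using ks1 by (simp add: ks)
    ultimately have "confounding_arcs G (drop p vs, rest)"
      using "1.IH" by blast
    moreover have "last (take (Suc p) vs) = hd (drop p vs)"
      using len by (simp add: take_Suc_conv_app_nth hd_drop_conv_nth ks p_def)
    ultimately have "confounding_arcs G (concat_walk (take (Suc p) vs, ks\<^sub>1) (drop p vs, rest))"
      by (intro confounding_arcs.append[OF arc]) (simp_all add: vertices_def)
    moreover have "concat_walk (take (Suc p) vs, ks\<^sub>1) (drop p vs, rest) = (vs, ks)"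
      by (simp add: concat_walk_def vertices_def kinds_def ks tl_drop flip: drop_Suc)
    ultimately show ?thesis by simp
  qed
qed

section \<open>Open walks\<close>

text \<open>Colliders must lie in \<open>A\<close>, all other non-endpoints outside \<open>S\<close>. In the application \<open>A\<close> is
  the set of ancestors of \<open>L\<close>, and \<open>S\<close> contains the two endpoints in addition to \<open>L\<close>.\<close>

definition passable :: "'v set \<Rightarrow> 'v set \<Rightarrow> kind \<Rightarrow> 'v \<Rightarrow> kind \<Rightarrow> bool" where
  "passable A S K v K' \<longleftrightarrow> (if K \<in> {Fwd, Bi} \<and> K' \<in> {Bwd, Bi} then v \<in> A else v \<notin> S)"

definition open_walk :: "'v mixed_graph \<Rightarrow> 'v set \<Rightarrow> 'v set \<Rightarrow> 'v list \<Rightarrow> kind list \<Rightarrow> bool" where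
  "open_walk G A S vs ks \<longleftrightarrow> is_walk G (vs, ks) \<and> hd ks \<in> {Bwd, Bi} \<and>
     (\<forall>i. 0 < i \<and> i < length ks \<longrightarrow> passable A S (ks ! (i - 1)) (vs ! i) (ks ! i))"

text \<open>The kind of the last edge is recorded because, together with the next edge, it decides
  whether \<open>v\<close> becomes a collider when the walk is extended.\<close>

definition reachable :: "'v mixed_graph \<Rightarrow> 'v set \<Rightarrow> 'v set \<Rightarrow> 'v \<Rightarrow> kind \<Rightarrow> 'v \<Rightarrow> bool" where
  "reachable G A S a K v \<longleftrightarrow>
     (\<exists>vs ks. open_walk G A S vs ks \<and> hd vs = a \<and> last vs = v \<and> last ks = K)"

lemma reachable_init:
  assumes "traversed_edge a K v \<in> edges G" "K \<in> {Bwd, Bi}"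
  shows "reachable G A S a K v"
proof -
  have "open_walk G A S [a, v] [K]"
    using assms by (auto simp: open_walk_def is_walk_Pair)
  then show ?thesis unfolding reachable_def
    by (metis last.simps list.sel(1) list.distinct(1))
qed

lemma reachable_step:
  assumes "reachable G A S a K v" "traversed_edge v K' u \<in> edges G" "passable A S K v K'"
  shows "reachable G A S a K' u"
proof -
  obtain vs ks where w: "open_walk G A S vs ks" "hd vs = a" "last vs = v" "last ks = K"
    using assms(1) by (auto simp: reachable_def)
  have len: "ks \<noteq> []" "length vs = Suc (length ks)" "vs \<noteq> []"
    using w(1) by (auto simp: open_walk_def is_walk_Pair)
  have v: "vs ! length ks = v" "ks ! (length ks - 1) = K"
    using w len by (simp_all add: last_conv_nth)
  have "open_walk G A S (vs @ [u]) (ks @ [K'])"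
    using w(1) assms(2,3) v len
    by (auto simp: open_walk_def is_walk_Pair nth_append less_Suc_eq)
  then show ?thesis using w len unfolding reachable_def
    by (metis hd_append2 last_snoc)
qed

text \<open>Cut out the loop between two visits to a vertex. Only the junction can change its
  collider status, so only there must \<open>passable\<close> be rechecked.\<close>

lemma reachable_shortcut:
  assumes acyc: "acyclic_graph G"
    and A: "A = {v. \<exists>l\<in>L. (v, l) \<in> (directed G)\<^sup>*}"
    and S: "S = insert j (insert k L)" and "j \<noteq> k" "j \<notin> A" "k \<notin> A"
    and w: "open_walk G A S vs ks" "hd vs = j" "last vs = k"
    and "\<not> distinct vs"
  obtains vs' ks' where "open_walk G A S vs' ks'" "hd vs' = j" "last vs' = k" "last ks' = last ks"
    "length ks' < length ks"
proof -
  define n where "n = length ks"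
  have walk: "is_walk G (vs, ks)" and len: "ks \<noteq> []" "length vs = Suc n" "vs \<noteq> []" "n > 0"
    and e: "\<And>i. i < n \<Longrightarrow> traversed_edge (vs ! i) (ks ! i) (vs ! Suc i) \<in> edges G"
    and hd: "hd ks \<in> {Bwd, Bi}"
    and pass: "\<And>i. 0 < i \<Longrightarrow> i < n \<Longrightarrow> passable A S (ks ! (i - 1)) (vs ! i) (ks ! i)"
    using w(1) by (auto simp: open_walk_def is_walk_Pair n_def)
  have ends: "vs ! 0 = j" "vs ! n = k" using w len by (simp_all add: hd_conv_nth last_conv_nth)
  \<comment> \<open>Both endpoints lie in \<open>S\<close> but not in \<open>A\<close>, so neither
    alternative of \<open>passable\<close> admits them as interior vertices. Hence every loop is
    interior.\<close>
  have inner: "vs ! i \<noteq> j" "vs ! i \<noteq> k" if "0 < i" "i < n" for i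
    using pass[OF that] \<open>j \<notin> A\<close> \<open>k \<notin> A\<close> by (auto simp: passable_def S split: if_splits)
  obtain p q where pq: "p < q" "q \<le> n" "vs ! p = vs ! q"
    using \<open>\<not> distinct vs\<close> len by (metis distinct_conv_nth linorder_neqE_nat less_Suc_eq_le)
  have "p > 0" using pq ends inner[of q] \<open>j \<noteq> k\<close> by (cases "q = n") (auto intro: gr0I)
  have "q < n" using pq ends inner[of p] \<open>p > 0\<close> by (cases "q = n") auto
  define vs' where "vs' = take (Suc p) vs @ drop (Suc q) vs"
  define ks' where "ks' = take p ks @ drop q ks"
  define d where "d = q - p"
  have len': "length ks' = n - d" "length vs' = Suc (n - d)"
    using pq \<open>q < n\<close> len by (auto simp: ks'_def vs'_def n_def[symmetric] d_def)
  have k1: "ks' ! i = ks ! i" if "i < p" for i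
    using that pq by (simp add: ks'_def nth_append n_def)
  have k2: "ks' ! i = ks ! (i + d)" if "p \<le> i" "i < n - d" for i
    using that pq by (auto simp: ks'_def nth_append n_def[symmetric] d_def intro!: arg_cong[where f="(!) ks"])
  have v1: "vs' ! i = vs ! i" if "i \<le> p" for i
    using that pq len by (simp add: vs'_def nth_append)
  \<comment> \<open>The index \<open>i = p\<close> is included because both visits are to the same
    vertex.\<close>
  have v2: "vs' ! i = vs ! (i + d)" if "p \<le> i" "i \<le> n - d" for i
  proof (cases "i = p")
    case True
    then show ?thesis using v1[of p] pq by (simp add: d_def)
  next
    case False
    then show ?thesis using that pq len
      by (auto simp: vs'_def nth_append d_def intro!: arg_cong[where f="(!) vs"])
  qed
  have mid: "passable A S (ks ! (p - 1)) (vs ! p) (ks ! q)"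
  proof (cases "ks ! (p - 1) \<in> {Fwd, Bi} \<and> ks ! q \<in> {Bwd, Bi}")
    case False
    \<comment> \<open>A non-collider at the junction was already a non-collider at one of the two
      visits.\<close>
    have "vs ! p \<notin> L"
    proof
      assume "vs ! p \<in> L"
      then have "\<not> vs ! p \<notin> S" "\<not> vs ! q \<notin> S" using pq S by auto
      then show False
        using False pass[of p] pass[of q] \<open>p > 0\<close> \<open>q < n\<close> pq by (auto simp: passable_def split: if_splits)
    qed
    then show ?thesis
      using False inner[of p] \<open>p > 0\<close> \<open>q < n\<close> pq by (auto simp: passable_def S)
  next
    case True
    have "vs ! p \<in> A"
    proof (cases "ks ! p = Fwd")
      case False
      then have "ks ! p \<in> {Bwd, Bi}" by (cases "ks ! p") auto
      then show ?thesis using True pass[of p] \<open>p > 0\<close> \<open>q < n\<close> pq by (auto simp: passable_def)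
    next
      case Fp: True
      txt \<open>The walk leaves its first visit to \<open>vs ! p\<close> along directed edges, and acyclicity forces
        a collider before it returns.\<close>
      have "\<exists>r. p \<le> r \<and> r < q \<and> ks ! r \<noteq> Fwd"
      proof (rule ccontr)
        assume "\<not> ?thesis"
        then have "(vertices (vs, ks) ! p, vertices (vs, ks) ! q) \<in> (directed G)\<^sup>+"
          using pq by (intro forward_segment_trancl[OF walk]) (auto simp: kinds_def n_def)
        then show False using pq acyc by (simp add: vertices_def acyclic_graph_iff acyclic_def)
      qed
      then obtain r where r: "p \<le> r" "r < q" "ks ! r \<noteq> Fwd"
        and least: "\<And>i. i < r \<Longrightarrow> \<not> (p \<le> i \<and> i < q \<and> ks ! i \<noteq> Fwd)"
        using exists_least_iff[of "\<lambda>r. p \<le> r \<and> r < q \<and> ks ! r \<noteq> Fwd"] by auto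
      have fwd: "ks ! i = Fwd" if "p \<le> i" "i < r" for i using least[of i] that r by auto
      have "p < r" using r Fp by (cases "p = r") auto
      have "(vertices (vs, ks) ! p, vertices (vs, ks) ! r) \<in> (directed G)\<^sup>+"
        using \<open>p < r\<close> r pq fwd by (intro forward_segment_trancl[OF walk]) (auto simp: kinds_def n_def)
      moreover have "vs ! r \<in> A"
      proof -
        have "ks ! (r - 1) = Fwd" using fwd[of "r - 1"] \<open>p < r\<close> by simp
        moreover have "ks ! r \<in> {Bwd, Bi}" using r(3) by (cases "ks ! r") auto
        ultimately show ?thesis using pass[of r] \<open>p < r\<close> r \<open>q < n\<close> by (auto simp: passable_def)
      qed
      ultimately show ?thesis by (auto simp: A vertices_def dest: trancl_into_rtrancl intro: rtrancl_trans)
    qed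
    with True show ?thesis by (simp add: passable_def)
  qed
  have pd: "p + d = q" using pq by (simp add: d_def)
  show thesis
  proof (rule that[of vs' ks'])
    have "traversed_edge (vs' ! i) (ks' ! i) (vs' ! Suc i) \<in> edges G" if "i < n - d" for i
    proof (cases "i < p")
      case True
      then show ?thesis using e[of i] k1[of i] v1[of i] v1[of "Suc i"] that by simp
    next
      case False
      then show ?thesis using e[of "i + d"] k2[of i] v2[of i] v2[of "Suc i"] that by simp
    qed
    then have "is_walk G (vs', ks')" using len' pd \<open>q < n\<close> by (auto simp: is_walk_Pair)
    moreover have "hd ks' \<in> {Bwd, Bi}" using hd len \<open>p > 0\<close> by (cases ks; cases p) (auto simp: ks'_def)
    moreover have "passable A S (ks' ! (i - 1)) (vs' ! i) (ks' ! i)" if i: "0 < i" "i < n - d" for i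
    proof -
      consider "i < p" | "i = p" | "p < i" by linarith
      then show ?thesis
      proof cases
        case 1
        then show ?thesis using pass[of i] k1[of i] k1[of "i - 1"] v1[of i] i by simp
      next
        case 2
        then show ?thesis using mid k1[of "p - 1"] k2[of p] v1[of p] \<open>p > 0\<close> i pd by simp
      next
        case 3
        have "i - 1 + d = i + d - 1" using i by simp
        then show ?thesis using 3 pass[of "i + d"] k2[of i] k2[of "i - 1"] v2[of i] i by simp
      qed
    qed
    ultimately show "open_walk G A S vs' ks'" using len' by (simp add: open_walk_def)
    show "hd vs' = j" using w(2) len by (cases vs) (auto simp: vs'_def)
    show "last vs' = k" using w(3) len \<open>q < n\<close> by (simp add: vs'_def last_append)
    show "last ks' = last ks" using \<open>q < n\<close> by (simp add: ks'_def last_append n_def)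
    show "length ks' < length ks" using len' pd pq \<open>q < n\<close> by (simp add: n_def)
  qed
qed

text \<open>A shortest open walk with the given last kind has no repeated vertex, since shortcuts
  preserve that kind. Its colliders lie in \<open>A\<close>, that is, in \<open>L\<close> or among
  the ancestors of \<open>L\<close>.\<close>

lemma reachable_imp_unblocked_confounding_path:
  assumes acyc: "acyclic_graph G"
    and A: "A = {v. \<exists>l\<in>L. (v, l) \<in> (directed G)\<^sup>*}"
    and S: "S = insert j (insert k L)" and jk: "j \<noteq> k" "j \<notin> A" "k \<notin> A"
    and r: "reachable G A S j K k" "K \<in> {Fwd, Bi}"
  shows "\<exists>w. confounding_path G w \<and> walk_between G j k w \<and> \<not> ancestrally_blocked G L w"
proof -
  define P where "P n \<longleftrightarrow> (\<exists>vs ks. open_walk G A S vs ks \<and> hd vs = j \<and> last vs = k \<and> last ks = K \<and>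
    length ks = n)" for n
  have "\<exists>n. P n" using r by (auto simp: P_def reachable_def)
  then obtain n where "P n" and least: "\<And>m. m < n \<Longrightarrow> \<not> P m"
    using exists_least_iff[of P] by auto
  then obtain vs ks where w: "open_walk G A S vs ks" "hd vs = j" "last vs = k" "last ks = K"
    and n: "length ks = n" by (auto simp: P_def)
  have "distinct vs"
  proof (rule ccontr)
    assume "\<not> distinct vs"
    from reachable_shortcut[OF acyc A S jk w(1-3) this] w(4) n least
    show False unfolding P_def by metis
  qed
  have walk: "is_walk G (vs, ks)" "hd ks \<in> {Bwd, Bi}" using w(1) by (auto simp: open_walk_def)
  have "confounding_path G (vs, ks)"
    using confounding_arcsI[OF walk] w(4) r(2) walk(1) \<open>distinct vs\<close>
    by (auto simp: confounding_path_def is_path_def vertices_def)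
  moreover have "walk_between G j k (vs, ks)"
    using walk w by (simp add: walk_between_def vertices_def)
  moreover have "\<not> ancestrally_blocked G L (vs, ks)"
  proof -
    have pass: "passable A S (ks ! (i - 1)) (vs ! i) (ks ! i)" if "nonendpoint (vs, ks) i" for i
      using w(1) that by (auto simp: open_walk_def nonendpoint_def kinds_def)
    have 1: "vs ! i \<in> L \<or> (\<exists>l\<in>L. (vs ! i, l) \<in> (directed G)\<^sup>+)" if "collider (vs, ks) i" for i
    proof -
      have "vs ! i \<in> A" using that pass[of i] by (auto simp: collider_def kinds_def passable_def)
      then show ?thesis by (auto simp: A rtrancl_eq_or_trancl)
    qed
    have 2: "vs ! i \<notin> L" if "nonendpoint (vs, ks) i" "\<not> collider (vs, ks) i" for i
      using that pass[of i] by (auto simp: collider_def kinds_def passable_def S split: if_splits)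
    show ?thesis using 1 2
      by (auto simp: ancestrally_blocked_def vertices_def right_directed_walk_exists_iff)
  qed
  ultimately show ?thesis by blast
qed

text \<open>Prolongs an open walk by a trek from \<open>a\<close> back to \<open>u\<close>, across
  to \<open>v\<close> and on to \<open>t\<close>. Edges of \<open>D\<close> never leave
  \<open>S\<close>, so the interior of the trek avoids \<open>S\<close>.\<close>

lemma reachable_trek:
  fixes S :: "'v set"
  assumes D: "D = {(a, b) \<in> directed G. a \<notin> S}"
    and start: "a = j \<or> (\<exists>K\<in>{Fwd, Bi}. reachable G A S j K a \<and> a \<in> A)"
    and treks: "(u, a) \<in> D\<^sup>*" "(v, t) \<in> D\<^sup>*" "u = v \<or> (u, v) \<in> bidirected G"
    and "a \<in> S" "t \<in> S" "a \<noteq> t"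
  shows "\<exists>K\<in>{Fwd, Bi}. reachable G A S j K t"
proof -
  have src: "b \<notin> S" "b \<noteq> c \<Longrightarrow> (b, c) \<in> D\<^sup>+" if "(b, c) \<in> D\<^sup>*" "b \<noteq> c" for b c
    using that by (auto simp: D rtrancl_eq_or_trancl elim: converse_tranclE)
  \<comment> \<open>Either the walk starts here, or \<open>a\<close> becomes a collider, which is
    allowed because \<open>a\<close> is in \<open>A\<close>.\<close>
  have first: "reachable G A S j K u" if "traversed_edge a K u \<in> edges G" "K \<in> {Bwd, Bi}" for K u
    using start that by (auto intro: reachable_init reachable_step simp: passable_def)
  have left: "reachable G A S j Bwd u" if "(u, a) \<in> D\<^sup>+" for u
    using that
  proof (induction rule: converse_trancl_induct)
    case (base u)
    then show ?case by (intro first) (auto simp: D)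
  next
    case (step u m)
    have "m \<notin> S" using step(2) by (auto simp: D elim: converse_tranclE)
    then show ?case using step by (intro reachable_step[OF step(3)]) (auto simp: D passable_def)
  qed
  have right: "reachable G A S j Fwd t" if "reachable G A S j K v" "v \<notin> S" "(v, t) \<in> D\<^sup>+" for K v t
    using that(3)
  proof (induction rule: trancl_induct)
    case (base t)
    then show ?case using that by (intro reachable_step[OF that(1)]) (auto simp: D passable_def)
  next
    case (step m t)
    then show ?case by (intro reachable_step[OF step(3)]) (auto simp: D passable_def)
  qed
  have u: "u \<noteq> a \<Longrightarrow> u \<notin> S \<and> reachable G A S j Bwd u" using src[OF treks(1)] left by auto
  have v: "v \<noteq> t \<Longrightarrow> v \<notin> S \<and> (v, t) \<in> D\<^sup>+" using src[OF treks(2)] by auto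
  show ?thesis
  \<comment> \<open>A common source differs from at least one of \<open>a\<close> and
    \<open>t\<close>, so it lies outside \<open>S\<close> and hence differs from both: the trek has
    edges on both sides.\<close>
  proof (cases "u = v")
    case True
    then show ?thesis using u v \<open>a \<in> S\<close> \<open>t \<in> S\<close> \<open>a \<noteq> t\<close> right by blast
  next
    case False
    then have "(u, v) \<in> bidirected G" using treks by auto
    then have "reachable G A S j Bi v"
    proof (cases "u = a")
      case True
      then show ?thesis using \<open>(u, v) \<in> bidirected G\<close> by (intro first) auto
    next
      case False
      then have "reachable G A S j Bwd u" "passable A S Bwd u Bi" using u by (auto simp: passable_def)
      then show ?thesis using \<open>(u, v) \<in> bidirected G\<close>
        by (auto intro: reachable_step[of G A S j Bwd u Bi v])
    qed
    then show ?thesis using v right by (cases "v = t") auto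
  qed
qed

section \<open>Quadratic form of the noise covariance\<close>

text \<open>For the noise covariance, this is the covariance of the linear combinations of the noise
  with coefficient vectors \<open>x\<close> and \<open>y\<close>.\<close>

definition form :: "real^'v^'v::finite \<Rightarrow> real^'v \<Rightarrow> real^'v \<Rightarrow> real" where
  "form A x y = x \<bullet> (A *v y)"

lemma linear_form: "linear (form A x)"
  unfolding form_def by (rule linearI) (simp_all add: matrix_vector_right_distrib
    matrix_vector_mult_scaleR inner_add_right)

lemmas form_right = linear_add[OF linear_form] linear_diff[OF linear_form]
  linear_scale[OF linear_form] linear_sum[OF linear_form] linear_0[OF linear_form]

lemma form_commute: "positive_definite A \<Longrightarrow> form A x y = form A y x"
  unfolding form_def positive_definite_def
  by (metis dot_lmul_matrix inner_commute transpose_matrix_vector)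

lemma form_pos: "positive_definite A \<Longrightarrow> x \<noteq> 0 \<Longrightarrow> form A x x > 0"
  by (simp add: form_def positive_definite_def)

lemma form_span_eq_0:
  assumes "z \<in> span B" "\<And>b. b \<in> B \<Longrightarrow> form A x b = 0"
  shows "form A x z = 0"
  using assms(1)
proof (rule span_induct)
  show "subspace {z. form A x z = 0}" by (simp add: subspace_def form_right)
qed (use assms in auto)

text \<open>Gram-Schmidt: \<open>p\<close> is the residual of the new vector \<open>m\<close>, and
  the old projection is corrected along \<open>p\<close>.\<close>

lemma form_projection_exists:
  assumes pd: "positive_definite A" and "finite B"
  shows "\<exists>z\<in>span B. \<forall>b\<in>B. form A (y - z) b = 0"
  using \<open>finite B\<close>
proof (induction B arbitrary: y rule: finite_induct)
  case empty
  show ?case by auto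
next
  case (insert m B)
  obtain z where z: "z \<in> span B" "\<And>b. b \<in> B \<Longrightarrow> form A (m - z) b = 0" using insert.IH[of m] by blast
  obtain z' where z': "z' \<in> span B" "\<And>b. b \<in> B \<Longrightarrow> form A (y - z') b = 0" using insert.IH[of y] by blast
  define p where "p = m - z"
  define t where "t = form A (y - z') p / form A p p"
  define u where "u = z' + t *\<^sub>R p"
  \<comment> \<open>If \<open>m\<close> already lies in the span of \<open>B\<close>, then
    \<open>p = 0\<close>, the quotient \<open>t\<close> is 0 by convention, and both sides
    vanish.\<close>
  have tp: "form A (y - z') p = t * form A p p"
    using form_pos[OF pd, of p] by (cases "p = 0") (auto simp: t_def form_right)
  have comm: "form A (y - u) b = form A b (y - z') - t * form A b p" for b
    by (subst form_commute[OF pd]) (simp add: u_def form_right algebra_simps flip: diff_diff_eq)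
  have old: "form A (y - u) b = 0" if "b \<in> B" for b
    using z(2)[OF that] z'(2)[OF that] form_commute[OF pd] by (metis comm p_def mult_zero_right diff_zero)
  have "form A (y - u) p = 0" using tp comm[of p] form_commute[OF pd, of "y - z'" p] by simp
  moreover have "form A (y - u) z = 0" by (rule form_span_eq_0[OF z(1) old])
  ultimately have "form A (y - u) m = 0" by (simp add: p_def form_right)
  moreover have "u \<in> span (insert m B)"
  proof -
    have "span B \<subseteq> span (insert m B)" by (rule span_mono) auto
    then show ?thesis unfolding u_def p_def using z(1) z'(1)
      by (intro span_add span_scale span_diff) (auto intro: span_base)
  qed
  ultimately show ?case using old by auto
qed

lemma span_image_coefficients:
  assumes "finite I" "z \<in> span (x ` I)"
  obtains c where "z = (\<Sum>i\<in>I. c i *\<^sub>R x i)"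
proof -
  have "subspace (range (\<lambda>c. \<Sum>i\<in>I. c i *\<^sub>R x i))" (is "subspace ?R")
  proof (intro subspaceI)
    show "0 \<in> ?R" by (rule range_eqI[of _ _ "\<lambda>_. 0"]) simp
  next
    fix u v assume "u \<in> ?R" "v \<in> ?R"
    then obtain c d where "u = (\<Sum>i\<in>I. c i *\<^sub>R x i)" "v = (\<Sum>i\<in>I. d i *\<^sub>R x i)" by auto
    then show "u + v \<in> ?R"
      by (intro range_eqI[of _ _ "\<lambda>i. c i + d i"]) (simp add: scaleR_add_left sum.distrib)
  next
    fix a u assume "u \<in> ?R"
    then obtain c where "u = (\<Sum>i\<in>I. c i *\<^sub>R x i)" by auto
    then show "a *\<^sub>R u \<in> ?R"
      by (intro range_eqI[of _ _ "\<lambda>i. a * c i"]) (simp add: scaleR_sum_right)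
  qed
  moreover have "x ` I \<subseteq> ?R"
  proof
    fix u assume "u \<in> x ` I"
    then obtain i where "i \<in> I" "u = x i" by blast
    then show "u \<in> ?R"
      using \<open>finite I\<close> by (intro range_eqI[of _ _ "\<lambda>k. if k = i then 1 else 0"])
        (simp add: if_distrib[of "\<lambda>r. r *\<^sub>R _"] cong: if_cong)
  qed
  ultimately have "span (x ` I) \<subseteq> ?R" by (intro span_minimal)
  then show ?thesis using assms(2) that by blast
qed

section \<open>Matrices supported on an acyclic relation\<close>

lemma acyclic_imp_wfs:
  fixes D :: "('v::finite \<times> 'v) set"
  assumes "acyclic D"
  shows "wf D" "wf (D\<inverse>)"
  using finite_acyclic_wf[of D] finite_acyclic_wf_converse[of D] assms by simp_all

text \<open>Induction from the sinks upwards shows that the kernel is trivial. The first-step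
  recursion then gives the support of the inverse.\<close>

lemma one_minus_acyclic_inverse:
  fixes N :: "real^'v^'v::finite"
  assumes "acyclic D" and supp: "\<And>a b. N $ a $ b \<noteq> 0 \<Longrightarrow> (a, b) \<in> D"
  obtains T where "T ** (mat 1 - N) = mat 1" "(mat 1 - N) ** T = mat 1"
    "\<And>u s. T $ u $ s = (if u = s then 1 else 0) + (\<Sum>m\<in>UNIV. N $ u $ m * T $ m $ s)"
    "\<And>u s. T $ u $ s \<noteq> 0 \<Longrightarrow> (u, s) \<in> D\<^sup>*"
proof -
  have "x = 0" if x: "(mat 1 - N) *v x = 0" for x
  proof -
    have eq: "x = N *v x" using x by (simp add: matrix_vector_mult_diff_rdistrib)
    have "x $ a = 0" for a
      using acyclic_imp_wfs(2)[OF assms(1)]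
    proof (induction a rule: wf_induct_rule)
      case (less a)
      have "x $ a = (\<Sum>m\<in>UNIV. N $ a $ m * x $ m)"
        by (subst eq) (simp add: matrix_vector_mult_def)
      also have "\<dots> = 0" using less supp by (intro sum.neutral) (metis converse_iff mult_eq_0_iff)
      finally show ?case .
    qed
    then show ?thesis by (simp add: vec_eq_iff)
  qed
  then obtain T where T: "T ** (mat 1 - N) = mat 1"
    using matrix_left_invertible_ker[of "mat 1 - N"] by blast
  then have T': "(mat 1 - N) ** T = mat 1" by (simp add: matrix_left_right_inverse)
  have rec: "T $ u $ s = (if u = s then 1 else 0) + (\<Sum>m\<in>UNIV. N $ u $ m * T $ m $ s)" for u s
  proof -
    have "((mat 1 - N) ** T) $ u $ s = T $ u $ s - (\<Sum>m\<in>UNIV. N $ u $ m * T $ m $ s)"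
      by (simp add: matrix_matrix_mult_def mat_def left_diff_distrib sum_subtractf
          if_distrib[of "\<lambda>r. r * _"] cong: if_cong)
    then have "mat 1 $ u $ s = T $ u $ s - (\<Sum>m\<in>UNIV. N $ u $ m * T $ m $ s)"
      unfolding T' .
    then show ?thesis by (simp add: mat_def split: if_splits)
  qed
  have "(u, s) \<in> D\<^sup>*" if "T $ u $ s \<noteq> 0" for u s
    using acyclic_imp_wfs(2)[OF assms(1)] that
  proof (induction u rule: wf_induct_rule)
    case (less u)
    show ?case
    proof (cases "u = s")
      case False
      then have "(\<Sum>m\<in>UNIV. N $ u $ m * T $ m $ s) \<noteq> 0" using less.prems rec[of u s] by simp
      then obtain m where "N $ u $ m * T $ m $ s \<noteq> 0"
        by (rule sum.not_neutral_contains_not_neutral)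
      then have "(u, m) \<in> D" "T $ m $ s \<noteq> 0" using supp by auto
      with less.IH[of m] show ?thesis by (auto intro: converse_rtrancl_into_rtrancl)
    qed simp
  qed
  with T T' rec show ?thesis by (rule that)
qed

section \<open>Regression coefficients of Gaussian linear systems\<close>

lemma integral_centered_gaussian:
  assumes "prob_space M" "centered_gaussian M Z C"
  shows "(\<integral>\<omega>. (a \<bullet> Z \<omega> - c)\<^sup>2 \<partial>M) = c\<^sup>2 + form C a a"
proof -
  interpret prob_space M by fact
  define s where "s = form C a a"
  have [measurable]: "Z \<in> borel_measurable M" using assms(2) by (simp add: centered_gaussian_def)
  have s: "s \<ge> 0" "s = 0 \<Longrightarrow> AE \<omega> in M. a \<bullet> Z \<omega> = 0"
    "s > 0 \<Longrightarrow> distributed M lborel (\<lambda>\<omega>. a \<bullet> Z \<omega>) (\<lambda>x. ennreal (normal_density 0 (sqrt s) x))"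
    using assms(2) by (auto simp: centered_gaussian_def s_def form_def Let_def)
  have "(\<integral>\<omega>. (a \<bullet> Z \<omega> - c)\<^sup>2 \<partial>M) = c\<^sup>2 + s"
  proof (cases "s = 0")
    case True
    have "(\<integral>\<omega>. (a \<bullet> Z \<omega> - c)\<^sup>2 \<partial>M) = (\<integral>\<omega>. c\<^sup>2 \<partial>M)"
      using s(2)[OF True] by (intro integral_cong_AE) auto
    then show ?thesis using True by (simp add: prob_space)
  next
    case False
    then have pos: "s > 0" using s(1) by simp
    let ?f = "normal_density 0 (sqrt s)"
    have sq: "sqrt s > 0" using pos by simp
    \<comment> \<open>Expand the square; the moments of order 2, 1 and 0 are \<open>s\<close>, 0 and
      1.\<close>
    have "has_bochner_integral lborel (\<lambda>x. ?f x * x\<^sup>2 - 2 * c * (?f x * x) + c\<^sup>2 * ?f x)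
        (s - 2 * c * 0 + c\<^sup>2 * 1)"
      using normal_moment_even[OF sq, of 0 1] normal_moment_odd[OF sq, of 0 0]
        normal_moment_even[OF sq, of 0 0] pos
      by (intro has_bochner_integral_add has_bochner_integral_diff has_bochner_integral_mult_right)
        (simp_all add: power2_eq_square)
    then have "(\<integral>x. ?f x * (x - c)\<^sup>2 \<partial>lborel) = s + c\<^sup>2"
      by (simp add: has_bochner_integral_iff power2_eq_square algebra_simps)
    moreover have "(\<integral>x. ?f x * (x - c)\<^sup>2 \<partial>lborel) = (\<integral>\<omega>. (a \<bullet> Z \<omega> - c)\<^sup>2 \<partial>M)"
      by (rule distributed_integral[OF s(3)[OF pos]]) auto
    ultimately show ?thesis by simp
  qed
  then show ?thesis by (simp add: s_def)
qed

text \<open>Almost surely \<open>X\<close> is the transpose of \<open>B\<close> applied to the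
  noise, so column \<open>i\<close> of \<open>B\<close> holds the noise coefficients of component
  \<open>i\<close>, and the prediction error has coefficients \<open>e\<close>.\<close>

lemma mean_squared_error_gaussian_linear_system:
  fixes G :: "'v::finite mixed_graph" and S :: "'v set" and k :: 'v and b :: "'v \<Rightarrow> real"
  assumes sys: "gaussian_linear_system G \<sigma> M X E"
    and inv: "(mat 1 - coeff_matrix G \<sigma>) ** B = mat 1"
  defines "e \<equiv> column k B - (\<Sum>i\<in>S. b i *\<^sub>R column i B)"
  shows "mean_squared_error (distr M borel X) k S c b = c\<^sup>2 + form (noise_covariance G \<sigma>) e e"
proof -
  let ?\<beta> = "coeff_matrix G \<sigma>"
  have M: "prob_space M" and [measurable]: "X \<in> borel_measurable M"
    and E: "centered_gaussian M E (noise_covariance G \<sigma>)"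
    and eq: "AE \<omega> in M. X \<omega> = transpose ?\<beta> *v X \<omega> + E \<omega>"
    using sys by (auto simp: gaussian_linear_system_def)
  have [measurable]: "E \<in> borel_measurable M" using E by (simp add: centered_gaussian_def)
  define w where "w = axis k 1 - (\<Sum>i\<in>S. b i *\<^sub>R axis i (1::real))"
  have w: "w \<bullet> x = x $ k - (\<Sum>i\<in>S. b i * x $ i)" for x
    by (simp add: w_def inner_diff_left inner_sum_left inner_axis')
  have Bw: "B *v w = e"
    by (simp add: w_def e_def matrix_vector_mult_diff_distrib
        linear_sum[OF matrix_vector_mul_linear] matrix_vector_mult_scaleR matrix_vector_mul_component
        matrix_vector_mult_basis)
  have ae: "w \<bullet> X \<omega> = e \<bullet> E \<omega>" if "X \<omega> = transpose ?\<beta> *v X \<omega> + E \<omega>" for \<omega>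
  proof -
    have "E \<omega> = X \<omega> - X \<omega> v* ?\<beta>"
      using that by (metis add_diff_cancel_left' transpose_matrix_vector)
    then have "e \<bullet> E \<omega> = X \<omega> \<bullet> ((mat 1 - ?\<beta>) *v (B *v w))"
      by (simp add: Bw inner_diff_right matrix_vector_mult_diff_rdistrib inner_commute[of e] dot_lmul_matrix)
    then show ?thesis by (simp add: matrix_vector_mul_assoc inv inner_commute)
  qed
  have "mean_squared_error (distr M borel X) k S c b = (\<integral>x. (w \<bullet> x - c)\<^sup>2 \<partial>distr M borel X)"
    unfolding mean_squared_error_def w by (simp add: algebra_simps)
  also have "\<dots> = (\<integral>\<omega>. (w \<bullet> X \<omega> - c)\<^sup>2 \<partial>M)"
    by (rule integral_distr) measurable
  also have "\<dots> = (\<integral>\<omega>. (e \<bullet> E \<omega> - c)\<^sup>2 \<partial>M)"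
    by (rule integral_cong_AE) (use eq ae in auto)
  also have "\<dots> = c\<^sup>2 + form (noise_covariance G \<sigma>) e e"
    by (rule integral_centered_gaussian[OF M E])
  finally show ?thesis .
qed

text \<open>Pythagoras: with a residual orthogonal to the regressors, any other choice of
  coefficients adds the form of \<open>d b'\<close> to the error, and an intercept adds its
  square.\<close>

lemma regression_coefficient_eqI:
  fixes G :: "'v::finite mixed_graph"
  assumes sys: "gaussian_linear_system G \<sigma> M X E"
    and pd: "positive_definite (noise_covariance G \<sigma>)"
    and inv: "(mat 1 - coeff_matrix G \<sigma>) ** B = mat 1"
    and orth: "\<And>i. i \<in> insert j L \<Longrightarrow> form (noise_covariance G \<sigma>)
      (column k B - (\<Sum>i\<in>insert j L. b i *\<^sub>R column i B)) (column i B) = 0"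
  shows "regression_coefficient (distr M borel X) k j L = b j"
proof -
  let ?Q = "form (noise_covariance G \<sigma>)" and ?mse = "mean_squared_error (distr M borel X) k (insert j L)"
  define r where "r = column k B - (\<Sum>i\<in>insert j L. b i *\<^sub>R column i B)"
  define d where "d b' = (\<Sum>i\<in>insert j L. (b i - b' i) *\<^sub>R column i B)" for b'
  have rd: "column k B - (\<Sum>i\<in>insert j L. b' i *\<^sub>R column i B) = r + d b'" for b'
    by (simp add: r_def d_def scaleR_diff_left sum_subtractf)
  have "?Q r (d b') = 0" for b'
    using orth by (simp add: d_def r_def form_right del: sum.insert_remove sum.insert)
  then have "?Q (r + d b') (r + d b') = ?Q r r + ?Q (d b') (d b')" for b'
    by (simp add: form_right form_commute[OF pd, of "r + d b'"] form_commute[OF pd, of "d b'" r])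
  then have mse: "?mse c b' = c\<^sup>2 + ?Q r r + ?Q (d b') (d b')" for c b'
    by (simp add: mean_squared_error_gaussian_linear_system[OF sys inv] rd)
  have Q0: "?Q y y \<ge> 0" for y using form_pos[OF pd, of y] by (cases "y = 0") (auto simp: form_right)
  have d0: "d b = 0" by (simp add: d_def)
  show ?thesis unfolding regression_coefficient_def
  proof (rule the_equality)
    have "linear_regression (distr M borel X) k (insert j L) 0 b"
      using Q0 by (simp add: linear_regression_def mse d0 form_right)
    then show "\<exists>c b'. linear_regression (distr M borel X) k (insert j L) c b' \<and> b j = b' j" by blast
  next
    fix g assume "\<exists>c b'. linear_regression (distr M borel X) k (insert j L) c b' \<and> g = b' j"
    then obtain c b' where "?mse c b' \<le> ?mse 0 b" and g: "g = b' j"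
      by (auto simp: linear_regression_def)
    then have "c\<^sup>2 + ?Q (d b') (d b') \<le> 0" by (simp add: mse d0 form_right)
    then have "\<not> ?Q (d b') (d b') > 0" using zero_le_power2[of c] by linarith
    then have "d b' = 0" using form_pos[OF pd] by blast
    \<comment> \<open>Injectivity of \<open>B\<close> turns \<open>d b' = 0\<close> into equality of
      the coefficients.\<close>
    moreover have "d b' = B *v (\<chi> i. if i \<in> insert j L then b i - b' i else 0)" (is "_ = B *v ?y")
      by (simp add: d_def matrix_mult_sum scalar_mult_eq_scaleR if_distrib[of "\<lambda>r. r *\<^sub>R _"] sum.If_cases
          cong: if_cong del: insert_iff)
    moreover have "?y = B' *v (B *v ?y)" if "B' ** B = mat 1" for B'
      by (simp add: matrix_vector_mul_assoc that)
    ultimately have "?y = 0" using inv by (metis matrix_vector_mult_0_right)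
    then have "?y $ j = 0" by simp
    then show "g = b j" using g by simp
  qed
qed

section \<open>The residual of the regression on the cause and the conditioning set\<close>

lemma matrix_add_rdistrib: "(A + B) ** C = A ** C + B ** C"
  by (simp add: vec_eq_iff matrix_matrix_mult_def distrib_right sum.distrib)

lemma noise_form_nonzeroE:
  assumes "form (noise_covariance G \<sigma>) (column s T) (column t T) \<noteq> 0"
  obtains u v where "T $ u $ s \<noteq> 0" "T $ v $ t \<noteq> 0" "(u, v) \<in> bidirected G"
proof -
  have "(\<Sum>u\<in>UNIV. \<Sum>v\<in>UNIV. T $ u $ s * (noise_covariance G \<sigma> $ u $ v * T $ v $ t)) \<noteq> 0"
    using assms by (simp add: form_def inner_vec_def matrix_vector_mult_def column_def sum_distrib_left)
  then obtain u where "(\<Sum>v\<in>UNIV. T $ u $ s * (noise_covariance G \<sigma> $ u $ v * T $ v $ t)) \<noteq> 0"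
    by (rule sum.not_neutral_contains_not_neutral)
  then obtain v where "T $ u $ s * (noise_covariance G \<sigma> $ u $ v * T $ v $ t) \<noteq> 0"
    by (rule sum.not_neutral_contains_not_neutral)
  then show thesis by (intro that[of u v]) (auto simp: noise_covariance_def split: if_splits)
qed

lemma coeff_matrix_nonzero: "coeff_matrix G \<sigma> $ a $ b \<noteq> 0 \<Longrightarrow> (a, b) \<in> directed G"
  by (simp add: coeff_matrix_def split: if_splits)

lemma regression_coefficients_exist:
  fixes G :: "'v::finite mixed_graph"
  assumes acyc: "acyclic_graph G" and pd: "positive_definite (noise_covariance G \<sigma>)"
    and B: "B ** (mat 1 - coeff_matrix G \<sigma>) = mat 1"
    and jk: "j \<noteq> k" "j \<notin> L" "k \<notin> L"
    and anc: "\<And>l. l \<in> L \<Longrightarrow> (j, l) \<notin> (directed G)\<^sup>+ \<and> (k, l) \<notin> (directed G)\<^sup>+"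
    and blocked: "\<not> (\<exists>w. confounding_path G w \<and> walk_between G j k w \<and> \<not> ancestrally_blocked G L w)"
    and dir: "(j, k) \<in> (directed G)\<^sup>+"
  obtains b where "b j = weight \<sigma> (right_directed_paths G j k)"
    "\<And>i. i \<in> insert j L \<Longrightarrow> form (noise_covariance G \<sigma>)
      (column k B - (\<Sum>i\<in>insert j L. b i *\<^sub>R column i B)) (column i B) = 0"
proof -
  let ?D = "directed G" and ?\<beta> = "coeff_matrix G \<sigma>" and ?Q = "form (noise_covariance G \<sigma>)"
  have aD: "acyclic ?D" using acyc by (simp add: acyclic_graph_iff)
  have irr: "(a, a) \<notin> ?D\<^sup>+" for a using aD by (simp add: acyclic_def)
  have kj: "(k, j) \<notin> ?D\<^sup>+" using dir irr trancl_trans by metis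
  define S where "S = insert j (insert k L)"
  define A where "A = {v. \<exists>l\<in>L. (v, l) \<in> ?D\<^sup>*}"
  have jkA: "j \<notin> A" "k \<notin> A" using anc jk by (auto simp: A_def rtrancl_eq_or_trancl)
  define D where "D = {(a, b) \<in> ?D. a \<notin> S}"
  have "D \<subseteq> ?D" by (auto simp: D_def)
  then have "acyclic D" using aD acyclic_subset by blast
  txt \<open>Removing the edges out of \<open>S\<close> from the graph turns all vertices of \<open>S\<close> into sinks.\<close>
  define N where "N = (\<chi> a b. if a \<in> S then 0 else ?\<beta> $ a $ b)"
  have N: "N $ a $ b \<noteq> 0 \<Longrightarrow> (a, b) \<in> D" for a b
    by (auto simp: N_def D_def coeff_matrix_nonzero split: if_splits)
  obtain T where T: "(mat 1 - N) ** T = mat 1"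
    and rec: "\<And>u s. T $ u $ s = (if u = s then 1 else 0) + (\<Sum>m\<in>UNIV. N $ u $ m * T $ m $ s)"
    and T_supp: "\<And>u s. T $ u $ s \<noteq> 0 \<Longrightarrow> (u, s) \<in> D\<^sup>*"
    by (rule one_minus_acyclic_inverse[OF \<open>acyclic D\<close>, of N]) (erule N, rule that)
  \<comment> \<open>\<open>x v\<close> and \<open>f v\<close> are the noise coefficients of
    component \<open>v\<close> in the original and in the cut system.\<close>
  define x where "x v = column v B" for v
  define f where "f v = column v T" for v
  define C where "C s v = (\<Sum>m\<in>UNIV. ?\<beta> $ s $ m * T $ m $ v)" for s v
  have C_supp: "(s, v) \<in> ?D\<^sup>+" if "C s v \<noteq> 0" for s v
  proof -
    obtain m where "?\<beta> $ s $ m * T $ m $ v \<noteq> 0"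
      using \<open>C s v \<noteq> 0\<close> unfolding C_def by (rule sum.not_neutral_contains_not_neutral)
    then have "(s, m) \<in> ?D" "(m, v) \<in> D\<^sup>*" using T_supp coeff_matrix_nonzero by auto
    then show ?thesis using rtrancl_mono[OF \<open>D \<subseteq> ?D\<close>] by (auto intro: rtrancl_into_trancl2)
  qed
  have xf: "x v = f v + (\<Sum>s\<in>S. C s v *\<^sub>R x s)" for v
  proof -
    \<comment> \<open>Write \<open>mat 1 - N\<close> as
      \<open>(mat 1 - ?\<beta>) + (?\<beta> - N)\<close> between \<open>B\<close> and
      \<open>T\<close>; only the rows of \<open>?\<beta> - N\<close> in \<open>S\<close>
      survive.\<close>
    have "B ** ((P + R) ** T) = (B ** P) ** T + B ** (R ** T)" for P R
      by (simp add: matrix_add_rdistrib matrix_add_ldistrib matrix_mul_assoc)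
    from this[of "mat 1 - ?\<beta>" "?\<beta> - N"] have "B = T + B ** ((?\<beta> - N) ** T)"
      by (simp add: T B)
    then have "B $ u $ v = (T + B ** ((?\<beta> - N) ** T)) $ u $ v" for u by (rule arg_cong)
    moreover have "((?\<beta> - N) ** T) $ s $ v = (if s \<in> S then C s v else 0)" for s
      by (auto simp: matrix_matrix_mult_def N_def C_def)
    ultimately have "B $ u $ v = T $ u $ v + (\<Sum>s\<in>UNIV. B $ u $ s * (if s \<in> S then C s v else 0))" for u
      by (subst (asm) matrix_matrix_mult_def) simp
    then show ?thesis
      by (simp add: vec_eq_iff x_def f_def column_def if_distrib[of "\<lambda>r. _ * r"] sum.If_cases mult.commute
          cong: if_cong)
  qed
  have C_jk: "C j k = weight \<sigma> (right_directed_paths G j k)"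
  proof -
    have "right_directed_paths G k k = {}"
      using acyc by (auto simp: acyclic_graph_def right_directed_walk_exists_def right_directed_paths_def)
    then have pk: "weight \<sigma> (right_directed_paths G k k) = 0" by (simp add: weight_def)
    \<comment> \<open>Descendants of \<open>j\<close> meet \<open>S\<close> at most in
      \<open>k\<close>. Elsewhere the rows of \<open>N\<close> and \<open>?\<beta>\<close> agree, so
      both sides obey one recursion; at \<open>k\<close> both are 1.\<close>
    have "T $ m $ k = (if m = k then 1 else 0) + weight \<sigma> (right_directed_paths G m k)"
      if "(j, m) \<in> ?D\<^sup>+" for m
      using acyclic_imp_wfs(2)[OF aD] that
    proof (induction m rule: wf_induct_rule)
      case (less m)
      show ?case
      proof (cases "m = k")
        case True
        then show ?thesis using rec[of k k] pk by (simp add: N_def S_def)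
      next
        case False
        then have "m \<notin> S" using less.prems irr anc by (auto simp: S_def)
        then have "T $ m $ k = (\<Sum>n\<in>UNIV. ?\<beta> $ m $ n * T $ n $ k)"
          using rec[of m k] False by (simp add: N_def)
        also have "\<dots> = (\<Sum>n\<in>UNIV. ?\<beta> $ m $ n *
            ((if n = k then 1 else 0) + weight \<sigma> (right_directed_paths G n k)))"
        proof (rule sum.cong[OF refl])
          fix n
          show "?\<beta> $ m $ n * T $ n $ k =
            ?\<beta> $ m $ n * ((if n = k then 1 else 0) + weight \<sigma> (right_directed_paths G n k))"
            using less.IH[of n] trancl_into_trancl[OF less.prems, of n] coeff_matrix_nonzero[of G \<sigma> m n]
            by (cases "?\<beta> $ m $ n = 0") auto
        qed
        finally show ?thesis using False by (simp add: weight_right_directed_paths[OF acyc, of \<sigma> m])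
      qed
    qed
    then show ?thesis
      unfolding C_def weight_right_directed_paths[OF acyc, of \<sigma> j]
      by (intro sum.cong refl) (metis coeff_matrix_nonzero mult_zero_left trancl.r_into_trancl)
  qed
  txt \<open>\<open>S\<^sub>1\<close> collects the vertices connected to \<open>j\<close> by chains of correlated \<open>f s\<close>.\<close>
  define S\<^sub>1 where "S\<^sub>1 = insert j {t \<in> L. \<exists>K\<in>{Fwd, Bi}. reachable G A S j K t}"
  define S\<^sub>2 where "S\<^sub>2 = L - S\<^sub>1"
  \<comment> \<open>A nonzero covariance gives a trek that continues the chain from \<open>j\<close>
    to \<open>t\<close>. For \<open>t = k\<close> this yields an unblocked confounding path;
    otherwise \<open>t\<close> would belong to \<open>S\<^sub>1\<close>.\<close>
  have block: "?Q (f s) (f t) = 0" if s: "s \<in> S\<^sub>1" and t: "t \<in> insert k S\<^sub>2" for s t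
  proof (rule ccontr)
    assume "?Q (f s) (f t) \<noteq> 0"
    then obtain u v where "(u, s) \<in> D\<^sup>*" "(v, t) \<in> D\<^sup>*" "(u, v) \<in> bidirected G"
      unfolding f_def by (rule noise_form_nonzeroE) (use T_supp in blast)
    moreover have "s \<in> S" "t \<in> S" "s \<noteq> t" using s t jk by (auto simp: S_def S\<^sub>1_def S\<^sub>2_def)
    moreover have "s = j \<or> (\<exists>K\<in>{Fwd, Bi}. reachable G A S j K s \<and> s \<in> A)"
      using s by (auto simp: S\<^sub>1_def A_def)
    ultimately obtain K where K: "K \<in> {Fwd, Bi}" "reachable G A S j K t"
      using reachable_trek[OF D_def, of s j A u v t] by blast
    show False
    proof (cases "t = k")
      case True
      then show False
        using reachable_imp_unblocked_confounding_path[OF acyc A_def S_def jk(1) jkA] K blocked by blast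
    next
      case False
      then show False using K t by (auto simp: S\<^sub>1_def S\<^sub>2_def)
    qed
  qed
  obtain z where z: "z \<in> span (f ` S\<^sub>2)" and z_orth: "\<And>l. l \<in> S\<^sub>2 \<Longrightarrow> ?Q (f k - z) (f l) = 0"
    using form_projection_exists[OF pd, of "f ` S\<^sub>2" "f k"] by auto
  define r where "r = f k - z"
  have r_f: "?Q r (f s) = 0" if "s \<in> insert j L" for s
  proof (cases "s \<in> S\<^sub>1")
    case True
    have "?Q (f s) z = 0" by (rule form_span_eq_0[OF z]) (use block True in auto)
    then have "?Q (f s) r = 0" using block[OF True, of k] by (simp add: r_def form_right)
    then show ?thesis by (simp add: form_commute[OF pd])
  next
    case False
    then show ?thesis using that z_orth by (auto simp: r_def S\<^sub>1_def S\<^sub>2_def)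
  qed
  \<comment> \<open>Neither \<open>j\<close> nor \<open>k\<close> is an ancestor of \<open>L\<close>
    or of \<open>j\<close>, so only vertices of \<open>L\<close> contribute here.\<close>
  have C_L: "s \<in> L" if "C s v \<noteq> 0" "s \<in> S" "v \<in> insert j L" for s v
    using C_supp[OF that(1)] that(2,3) anc irr kj by (auto simp: S_def)
  have r_x: "?Q r (x v) = 0" if IH: "\<And>l. l \<in> L \<Longrightarrow> (l, v) \<in> ?D\<^sup>+ \<Longrightarrow> ?Q r (x l) = 0"
    and v: "v \<in> insert j L" for v
  proof -
    have "C s v * ?Q r (x s) = 0" if "s \<in> S" for s
      using C_L[OF _ that v] C_supp[of s v] IH[of s] by auto
    then have "(\<Sum>s\<in>S. C s v * ?Q r (x s)) = 0" by (intro sum.neutral) blast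
    then show ?thesis by (subst xf) (simp add: form_right r_f[OF v])
  qed
  \<comment> \<open>Orthogonality passes from \<open>f\<close> to \<open>x\<close> along the
    ancestral order on \<open>L\<close>, and then to \<open>j\<close>.\<close>
  have r_L: "?Q r (x l) = 0" if "l \<in> L" for l
    using wf_trancl[OF acyclic_imp_wfs(1)[OF aD]] that
    by (induction l rule: wf_induct_rule) (auto intro: r_x)
  then have r_jL: "?Q r (x v) = 0" if "v \<in> insert j L" for v
    by (rule r_x) (use r_L that in auto)
  \<comment> \<open>So \<open>z\<close> is a combination of the \<open>x l\<close> with
    \<open>l\<close> in \<open>L\<close> alone, and the coefficient of \<open>x j\<close> in the
    residual comes only from \<open>C j k\<close>.\<close>
  have "f l \<in> span (x ` L)" if "l \<in> L" for l
  proof -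
    have "(\<Sum>s\<in>S. C s l *\<^sub>R x s) \<in> span (x ` L)"
    proof (rule span_sum)
      fix s assume "s \<in> S"
      then show "C s l *\<^sub>R x s \<in> span (x ` L)"
        using C_L[of s l] that by (cases "C s l = 0") (auto intro: span_scale span_base span_zero)
    qed
    then have "x l - (\<Sum>s\<in>S. C s l *\<^sub>R x s) \<in> span (x ` L)"
      using that by (intro span_diff) (auto intro: span_base)
    then show ?thesis by (simp add: xf[of l])
  qed
  then have "span (f ` S\<^sub>2) \<subseteq> span (x ` L)"
    by (intro span_minimal) (auto simp: S\<^sub>2_def)
  then have "z \<in> span (x ` L)" using z by blast
  then have "(\<Sum>l\<in>L. C l k *\<^sub>R x l) + z \<in> span (x ` L)"
    by (intro span_add span_sum span_scale) (auto intro: span_base)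
  then obtain c where c: "(\<Sum>l\<in>L. C l k *\<^sub>R x l) + z = (\<Sum>l\<in>L. c l *\<^sub>R x l)"
    using span_image_coefficients[of L _ x] by auto
  define b where "b = c(j := C j k)"
  have "C k k = 0" using C_supp[of k k] irr by blast
  then have "x k = f k + C j k *\<^sub>R x j + (\<Sum>l\<in>L. C l k *\<^sub>R x l)"
    using jk by (subst xf) (simp add: S_def)
  moreover have "(\<Sum>i\<in>insert j L. b i *\<^sub>R x i) = C j k *\<^sub>R x j + (\<Sum>l\<in>L. c l *\<^sub>R x l)"
    using jk by (simp add: b_def) (intro sum.cong, auto)
  ultimately have "r = x k - (\<Sum>i\<in>insert j L. b i *\<^sub>R x i)"
    by (simp add: r_def algebra_simps flip: c)
  then show thesis
    using r_jL C_jk by (intro that[of b]) (auto simp: b_def x_def)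
qed

theorem theorem6:
  fixes G :: "'v::finite mixed_graph"
    and \<sigma> :: "'v edge \<Rightarrow> real"
    and M :: "'w measure"
    and X E :: "'w \<Rightarrow> real^'v"
    and P :: "(real^'v) measure"
    and j k :: 'v
    and L :: "'v set"
  assumes "directed_mixed_graph G" and "canonical G" and "acyclic_graph G"
    and "gaussian_linear_system G \<sigma> M X E"
    and "nonsingular_system G \<sigma>"
    and "positive_definite (noise_covariance G \<sigma>)"
    and "P = distr M borel X"
    and "j \<noteq> k" and "j \<notin> L" and "k \<notin> L"
    and "\<not> (\<exists>l \<in> L. right_directed_walk_exists G j l \<or> right_directed_walk_exists G k l)"
    and "\<not> (\<exists>w. confounding_path G w \<and> walk_between G j k w \<and> \<not> ancestrally_blocked G L w)"
    and "right_directed_walk_exists G j k"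
  shows "regression_coefficient P k j L = weight \<sigma> (right_directed_paths G j k)"
proof -
  obtain B where B: "(mat 1 - coeff_matrix G \<sigma>) ** B = mat 1" "B ** (mat 1 - coeff_matrix G \<sigma>) = mat 1"
    using assms(5) by (auto simp: nonsingular_system_def invertible_def)
  obtain b where b: "b j = weight \<sigma> (right_directed_paths G j k)"
    "\<And>i. i \<in> insert j L \<Longrightarrow> form (noise_covariance G \<sigma>)
      (column k B - (\<Sum>i\<in>insert j L. b i *\<^sub>R column i B)) (column i B) = 0"
    by (rule regression_coefficients_exist[OF assms(3,6) B(2) assms(8-10) _ assms(12)])
      (use assms(11,13) in \<open>auto simp: right_directed_walk_exists_iff intro: that\<close>)
  have "regression_coefficient (distr M borel X) k j L = b j"
    by (rule regression_coefficient_eqI[OF assms(4,6) B(1) b(2)])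
  then show ?thesis using b(1) assms(7) by simp
qed

end
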